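(* Let $\mathcal{O}$ be the split Okubo algebra over a field $\mathbb{F}$ such that $\operatorname{char}\mathbb{F}\neq 3$ and $\mathbb{F}$ contains a primitive cube root of unity. Let $x,y\in Z(\mathcal{O})$ be such that $d([x],[y])=k$ in the orthogonality graph $\Gamma_O(\mathcal{O})$, $0\leq k\leq 5$. Then either there exists a unique path of length $k$ between $[x]$ and $[y]$, or there are exactly two such paths. The second possibility is achieved precisely in the following cases: (1) $d([x],[y])=3$, and $x*x=y*y=0$; (2) $d([x],[y])=4$, and $x*x=0$ or $y*y=0$; (3) $d([x],[y])=5$.
   Context: The split Okubo algebra over a field $\mathbb{F}$ is the $8$-dimensional $\mathbb{F}$-algebra $\mathcal{O}=\mathcal{O}_{1,1}$ with basis $z_{1,0},z_{2,0},z_{0,1},z_{0,2},z_{1,1},z_{2,2},z_{1,2},z_{2,1}$ and (bilinear, non-associative) multiplication $*$ given by the table (the entry in row $a$, column $b$ is $a*b$): $$\begin{array}{c|cccccccc} * & z_{1,0} & z_{2,0} & z_{0,1} & z_{0,2} & z_{1,1} & z_{2,2} & z_{1,2} & z_{2,1}\\ \hline z_{1,0} & z_{2,0} & 0 & -z_{1,1} & 0 & -z_{2,1} & 0 & 0 & -z_{0,1}\\ z_{2,0} & 0 & z_{1,0} & 0 & -z_{2,2} & 0 & -z_{1,2} & -z_{0,2} & 0\\ z_{0,1} & 0 & -z_{2,1} & z_{0,2} & 0 & 0 & -z_{2,0} & 0 & -z_{2,2}\\ z_{0,2} & -z_{1,2} & 0 & 0 & z_{0,1} & -z_{1,0} &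 0 & -z_{1,1} & 0\\ z_{1,1} & 0 & -z_{0,1} & -z_{1,2} & 0 & z_{2,2} & 0 & -z_{2,0} & 0\\ z_{2,2} & -z_{0,2} & 0 & 0 & -z_{2,1} & 0 & z_{1,1} & 0 & -z_{1,0}\\ z_{1,2} & -z_{2,2} & 0 & -z_{1,0} & 0 & 0 & -z_{0,1} & z_{2,1} & 0\\ z_{2,1} & 0 & -z_{1,1} & 0 & -z_{2,0} & -z_{0,2} & 0 & 0 & z_{1,2}\end{array}$$ $Z(\mathcal{O})$ is the set of zero divisors, i.e. nonzero $a$ such that $a*b=0$ or $b*a=0$ for some nonzero $b$; in $\mathcal{O}$ every zero divisor is two-sided. For $x\neq0$ write $[x]=\mathbb{F}x$. The orthogonality graph $\Gamma_O(\mathcal{O})$ is the undirected graph whose vertices are the lines $[a]$ with $a$ a two-sided zero divisor, two distinct vertices $[a],[b]$ being adjacent if and only if $a*b=b*a=0$; $d$ is the graph distance. *)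

theory Defs
  imports
    "HOL-Analysis.Cartesian_Space"
    "Graph_Theory.Graph_Theory"
begin

text \<open>The index \<open>Iij\<close> stands for the basis element with subscript \<open>i,j\<close>; the constructors are
  listed in the order of the rows and columns of the multiplication table.\<close>

datatype okubo_index = I10 | I20 | I01 | I02 | I11 | I22 | I12 | I21

lemma UNIV_okubo_index: "UNIV = {I10, I20, I01, I02, I11, I22, I12, I21}"
  using okubo_index.exhaust by auto

instance okubo_index :: finite
  by standard (simp add: UNIV_okubo_index)

type_synonym 'a okubo = "'a ^ okubo_index"

abbreviation zz :: "okubo_index \<Rightarrow> 'a::field okubo" where
  "zz i \<equiv> axis i 1"

text \<open>One equation per row; the arguments of \<open>case_okubo_index\<close> are the entries of that row,
  column by column.\<close>

primrec okubo_table :: "okubo_index \<Rightarrow> okubo_index \<Rightarrow> 'a::field okubo" where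
  "okubo_table I10 = case_okubo_index
     (zz I20) 0 (- zz I11) 0 (- zz I21) 0 0 (- zz I01)"
| "okubo_table I20 = case_okubo_index
     0 (zz I10) 0 (- zz I22) 0 (- zz I12) (- zz I02) 0"
| "okubo_table I01 = case_okubo_index
     0 (- zz I21) (zz I02) 0 0 (- zz I20) 0 (- zz I22)"
| "okubo_table I02 = case_okubo_index
     (- zz I12) 0 0 (zz I01) (- zz I10) 0 (- zz I11) 0"
| "okubo_table I11 = case_okubo_index
     0 (- zz I01) (- zz I12) 0 (zz I22) 0 (- zz I20) 0"
| "okubo_table I22 = case_okubo_index
     (- zz I02) 0 0 (- zz I21) 0 (zz I11) 0 (- zz I10)"
| "okubo_table I12 = case_okubo_index
     (- zz I22) 0 (- zz I10) 0 0 (- zz I01) (zz I21) 0"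
| "okubo_table I21 = case_okubo_index
     0 (- zz I11) 0 (- zz I20) (- zz I02) 0 0 (zz I12)"

definition okubo_mult :: "'a::field okubo \<Rightarrow> 'a okubo \<Rightarrow> 'a okubo"  (infixl \<open>\<star>\<close> 70) where
  "x \<star> y = (\<Sum>i\<in>UNIV. \<Sum>j\<in>UNIV. (x $ i * y $ j) *s okubo_table i j)"

definition zero_divisors :: "'a::field okubo set" where
  "zero_divisors = {a. a \<noteq> 0 \<and> (\<exists>b. b \<noteq> 0 \<and> (a \<star> b = 0 \<or> b \<star> a = 0))}"

definition two_sided_zero_divisors :: "'a::field okubo set" where
  "two_sided_zero_divisors =
     {a. a \<noteq> 0 \<and> (\<exists>b. b \<noteq> 0 \<and> a \<star> b = 0) \<and> (\<exists>b. b \<noteq> 0 \<and> b \<star> a = 0)}"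

definition line :: "'a::field okubo \<Rightarrow> 'a okubo set" where
  "line x = range (\<lambda>c. c *s x)"

text \<open>The undirected orthogonality graph is represented as a digraph whose arcs are the ordered
  pairs of adjacent vertices.\<close>

definition orthogonality_graph :: "'a::field okubo set pair_pre_digraph" where
  "orthogonality_graph = \<lparr>
     pverts = line ` two_sided_zero_divisors,
     parcs = {(line a, line b) | a b.
       a \<in> two_sided_zero_divisors \<and> b \<in> two_sided_zero_divisors \<and> line a \<noteq> line b \<and>
       a \<star> b = 0 \<and> b \<star> a = 0} \<rparr>"

lemma wf_orthogonality_graph: "wf_digraph (with_proj orthogonality_graph)"
  by unfold_locales (auto simp: orthogonality_graph_def)

lemma symmetric_orthogonality_graph: "symmetric (with_proj orthogonality_graph)"
  by (auto simp: orthogonality_graph_def symmetric_def intro!: symI)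

text \<open>With unit arc weights, \<open>wf_digraph.\<mu>\<close> is the graph distance (infinite between different
  components).\<close>

definition graph_distance :: "'v pair_pre_digraph \<Rightarrow> 'v \<Rightarrow> 'v \<Rightarrow> ereal" where
  "graph_distance G u v = wf_digraph.\<mu> (with_proj G) (\<lambda>_. 1) u v"

text \<open>The arcs of a path are pairs of vertices, so paths given as arc lists correspond one-to-one
  to paths given as vertex sequences.\<close>

definition paths_of_length :: "'v pair_pre_digraph \<Rightarrow> 'v \<Rightarrow> 'v \<Rightarrow> nat \<Rightarrow> ('v \<times> 'v) awalk set" where
  "paths_of_length G u v k = {p. pre_digraph.apath (with_proj G) u p v \<and> length p = k}"

definition primitive_cube_root_of_unity :: "'a::field \<Rightarrow> bool" where
  "primitive_cube_root_of_unity w \<longleftrightarrow> w ^ 3 = 1 \<and> (\<forall>m. 0 < m \<and> m < 3 \<longrightarrow> w ^ m \<noteq> 1)"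

end

theory Submission
  imports Defs "HOL-Analysis.Determinants"
begin

text \<open>Sending the basis element with subscript \<open>i,j\<close> to a scalar multiple of \<open>D\<^sup>i
  P\<^sup>j\<close>, where \<open>D\<close> is the diagonal matrix of the cube roots of unity and \<open>P\<close> a cyclic
  permutation matrix, identifies the algebra with the trace-zero \<open>3 \<times> 3\<close> matrices under a product which is a
  combination of \<open>XY\<close>, \<open>YX\<close> and \<open>tr(XY)\<close>. There \<open>x \<star> y = y \<star> x =
  0\<close> means that \<open>XY = YX\<close> is scalar, and for a zero divisor \<open>x\<close> the element \<open>x \<star>
  x\<close> is the adjugate of \<open>X\<close>. If the adjugate is nonzero, it spans the only neighbour of \<open>[x]\<close>:
  either \<open>[x]\<close> and \<open>[x \<star> x]\<close> form a component of the graph, or \<open>[x]\<close> hangs on the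
  vertex \<open>[x \<star> x]\<close>, whose square vanishes. A zero divisor of square zero is a matrix \<open>v f\<^sup>T\<close>
  with \<open>f v = 0\<close>, that is, a flag of the projective plane, and two such flags are adjacent when they share their
  point or their line. Geodesics between flags are unique, except that two opposite flags are joined by the two halves of an
  apartment (a hexagon); each of the two endpoints may hang on such a flag, which lengthens the distance by one.\<close>

section \<open>The multiplication\<close>

lemma forall_okubo_index:
  "(\<forall>i. P i) \<longleftrightarrow> P I10 \<and> P I20 \<and> P I01 \<and> P I02 \<and> P I11 \<and> P I22 \<and> P I12 \<and> P I21"
  by (metis okubo_index.exhaust)

lemma okubo_mult_nth:
  fixes x y :: "'a::field okubo"
  shows "(x \<star> y) $ I10 = x$I20 * y$I20 - x$I22 * y$I21 - x$I12 * y$I01 - x$I02 * y$I11"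
    and "(x \<star> y) $ I20 = x$I10 * y$I10 - x$I11 * y$I12 - x$I21 * y$I02 - x$I01 * y$I22"
    and "(x \<star> y) $ I01 = x$I02 * y$I02 - x$I11 * y$I20 - x$I12 * y$I22 - x$I10 * y$I21"
    and "(x \<star> y) $ I02 = x$I01 * y$I01 - x$I21 * y$I11 - x$I22 * y$I10 - x$I20 * y$I12"
    and "(x \<star> y) $ I11 = x$I22 * y$I22 - x$I21 * y$I20 - x$I02 * y$I12 - x$I10 * y$I01"
    and "(x \<star> y) $ I22 = x$I11 * y$I11 - x$I12 * y$I10 - x$I01 * y$I21 - x$I20 * y$I02"
    and "(x \<star> y) $ I12 = x$I21 * y$I21 - x$I02 * y$I10 - x$I11 * y$I01 - x$I20 * y$I22"
    and "(x \<star> y) $ I21 = x$I12 * y$I12 - x$I22 * y$I02 - x$I01 * y$I20 - x$I10 * y$I11"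
  by (simp_all add: okubo_mult_def UNIV_okubo_index axis_def)

text \<open>The quadratic form of the symmetric composition algebra: \<open>okubo_mult_right\<close>
  and \<open>okubo_mult_left\<close> are its characteristic identities. In the matrix model,
  \<open>- 3 * okubo_norm x\<close> is the sum of the principal minors of size two.\<close>

definition okubo_norm :: "'a::field okubo \<Rightarrow> 'a" where
  "okubo_norm x = x$I10 * x$I20 + x$I01 * x$I02 + x$I11 * x$I22 + x$I12 * x$I21"

lemma okubo_mult_right: "(x \<star> y) \<star> x = okubo_norm x *s y"
  unfolding vec_eq_iff forall_okubo_index
  by (simp add: okubo_mult_nth okubo_norm_def algebra_simps)

lemma okubo_mult_left: "x \<star> (y \<star> x) = okubo_norm x *s y"
  unfolding vec_eq_iff forall_okubo_index
  by (simp add: okubo_mult_nth okubo_norm_def algebra_simps)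

lemma okubo_mult_zero [simp]: "0 \<star> x = 0" "x \<star> 0 = 0"
  by (simp_all add: okubo_mult_def)

lemma okubo_mult_scale: "(c *s x) \<star> y = c *s (x \<star> y)" "x \<star> (c *s y) = c *s (x \<star> y)"
  unfolding vec_eq_iff forall_okubo_index
  by (simp_all add: okubo_mult_nth algebra_simps)

text \<open>If \<open>b\<close> annihilates \<open>x\<close> on some side, one of the two norm
  identities gives \<open>okubo_norm x *s b = 0\<close>. Conversely, norm zero makes
  \<open>x \<star> x\<close> annihilate \<open>x\<close> from both sides.\<close>

lemma zero_divisor_iff:
  "x \<in> zero_divisors \<longleftrightarrow> x \<noteq> 0 \<and> okubo_norm x = 0"
  "x \<in> two_sided_zero_divisors \<longleftrightarrow> x \<noteq> 0 \<and> okubo_norm x = 0"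
proof -
  have norm: "okubo_norm x = 0" if "x \<in> zero_divisors"
  proof -
    obtain b where "b \<noteq> 0" "x \<star> b = 0 \<or> b \<star> x = 0"
      using \<open>x \<in> zero_divisors\<close> by (auto simp: zero_divisors_def)
    then have "okubo_norm x *s b = 0"
      by (metis okubo_mult_left okubo_mult_right okubo_mult_zero)
    with \<open>b \<noteq> 0\<close> show ?thesis by simp
  qed
  have two: "x \<in> two_sided_zero_divisors" if "x \<noteq> 0" "okubo_norm x = 0"
  proof -
    have "x \<star> (x \<star> x) = 0" "(x \<star> x) \<star> x = 0"
      by (simp_all add: okubo_mult_left okubo_mult_right that)
    \<comment> \<open>The annihilator is \<open>x \<star> x\<close>, or \<open>x\<close> itself when
      that square vanishes.\<close>
    with \<open>x \<noteq> 0\<close> show ?thesis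
      unfolding two_sided_zero_divisors_def by (cases "x \<star> x = 0") blast+
  qed
  have "two_sided_zero_divisors \<subseteq> zero_divisors"
    unfolding two_sided_zero_divisors_def zero_divisors_def by blast
  moreover have "x \<noteq> 0" if "x \<in> zero_divisors"
    using that by (simp add: zero_divisors_def)
  ultimately show "x \<in> zero_divisors \<longleftrightarrow> x \<noteq> 0 \<and> okubo_norm x = 0"
    "x \<in> two_sided_zero_divisors \<longleftrightarrow> x \<noteq> 0 \<and> okubo_norm x = 0"
    using norm two by blast+
qed

text \<open>Adjacency without the condition that the lines differ; an element of square zero is thus
  \<open>orth\<close> to itself.\<close>

definition orth :: "'a::field okubo \<Rightarrow> 'a okubo \<Rightarrow> bool" where
  "orth x y \<longleftrightarrow> x \<star> y = 0 \<and> y \<star> x = 0"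

section \<open>Rank-one matrices of size three\<close>

definition dot3 :: "'a::comm_ring_1 ^ 3 \<Rightarrow> 'a ^ 3 \<Rightarrow> 'a" where
  "dot3 f v = f$1 * v$1 + f$2 * v$2 + f$3 * v$3"

definition cross :: "'a::comm_ring_1 ^ 3 \<Rightarrow> 'a ^ 3 \<Rightarrow> 'a ^ 3" where
  "cross f g = vector [f$2 * g$3 - f$3 * g$2, f$3 * g$1 - f$1 * g$3, f$1 * g$2 - f$2 * g$1]"

definition outer :: "'a::comm_ring_1 ^ 3 \<Rightarrow> 'a ^ 3 \<Rightarrow> 'a ^ 3 ^ 3" where
  "outer v f = (\<chi> i j. v$i * f$j)"

lemma dot3_scale [simp]: "dot3 (c *s f) v = c * dot3 f v" "dot3 f (c *s v) = c * dot3 f v"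
  by (simp_all add: dot3_def algebra_simps)

lemma dot3_cross [simp]: "dot3 f (cross f g) = 0" "dot3 g (cross f g) = 0"
  "dot3 (cross f g) f = 0" "dot3 (cross f g) g = 0"
  by (simp_all add: dot3_def cross_def algebra_simps)

lemma dot3_cross_cross:
  "dot3 (cross v w) (cross f g) = dot3 v f * dot3 w g - dot3 v g * dot3 w f"
  by (simp add: dot3_def cross_def algebra_simps)

lemma dot3_commute: "dot3 f v = dot3 v f"
  by (simp add: dot3_def algebra_simps)

lemma cross_cross: "cross v (cross f g) = dot3 v g *s f - dot3 v f *s g"
  by (simp add: vec_eq_iff forall_3 dot3_def cross_def algebra_simps)

lemma cross_refl [simp]: "cross f f = 0"
  by (simp add: vec_eq_iff forall_3 cross_def)

lemma cross_eq_0_commute: "cross f g = 0 \<longleftrightarrow> cross g f = 0"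
  unfolding vec_eq_iff forall_3 cross_def by (simp add: mult.commute) metis

lemma cross_eq_0D:
  fixes v w :: "'a::field ^ 3"
  assumes "cross v w = 0" "v \<noteq> 0"
  obtains c where "w = c *s v"
proof -
  obtain i where i: "v $ i \<noteq> 0" using \<open>v \<noteq> 0\<close> by (auto simp: vec_eq_iff)
  have "v$1 * w$2 = v$2 * w$1" "v$2 * w$3 = v$3 * w$2" "v$3 * w$1 = v$1 * w$3"
    using assms(1) by (simp_all add: cross_def vec_eq_iff forall_3)
  then have "v$i * w$j = w$i * v$j" for j
    using exhaust_3[of i] exhaust_3[of j] by (metis mult.commute)
  then have "w$j = (w$i / v$i) * v$j" for j using i by (simp add: field_simps)
  then have "w = (w$i / v$i) *s v" unfolding vec_eq_iff vector_smult_component by blast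
  then show ?thesis by (rule that)
qed

text \<open>Two independent linear forms have a one-dimensional common kernel, spanned by their
  cross product. The expansion of the double cross product shows that \<open>v\<close> is parallel
  to it.\<close>

lemma orthogonal_pairE:
  fixes v f g :: "'a::field ^ 3"
  assumes "cross f g \<noteq> 0" "dot3 f v = 0" "dot3 g v = 0"
  obtains c where "v = c *s cross f g"
proof -
  have "cross v (cross f g) = 0"
    using assms by (simp add: cross_cross dot3_commute)
  then show ?thesis using assms(1) cross_eq_0D that cross_eq_0_commute by metis
qed

lemma outer_eq_0_iff: "outer v f = 0 \<longleftrightarrow> v = 0 \<or> f = (0 :: 'a::field ^ 3)"
  by (auto simp: outer_def vec_eq_iff)

text \<open>Scalar multiples of matrices are written as products with scalar matrices
  \<open>mat c\<close>, because \<open>*s\<close> on a matrix would take a row vector as its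
  scalar.\<close>

lemma mat_mult_nth: "(mat c ** A) $ i $ j = c * (A :: 'a::comm_ring_1 ^ 'n ^ 'n) $ i $ j"
  by (simp add: matrix_matrix_mult_def mat_def if_distrib[of "\<lambda>x. x * _"] cong: if_cong)

lemma mult_mat_nth: "(A ** mat c) $ i $ j = (A :: 'a::comm_ring_1 ^ 'n ^ 'n) $ i $ j * c"
proof -
  have "A $ i $ k * mat c $ k $ j = (if k = j then A $ i $ k * c else 0)" for k
    by (simp add: mat_def)
  then show ?thesis by (simp add: matrix_matrix_mult_def)
qed

lemma outer_scale: "outer (a *s v) (b *s f) = mat (a * b) ** outer v f"
  by (simp add: outer_def vec_eq_iff mat_mult_nth algebra_simps)

lemma outer_mult: "outer v f ** outer w g = mat (dot3 f w) ** outer v g"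
proof -
  have "(outer v f ** outer w g) $ i $ j = dot3 f w * (v $ i * g $ j)" for i j
    by (simp add: outer_def matrix_matrix_mult_def sum_3 dot3_def algebra_simps)
  then show ?thesis by (simp add: vec_eq_iff mat_mult_nth outer_def)
qed

lemma trace_outer: "trace (outer v f) = dot3 f v"
  by (simp add: outer_def trace_def sum_3 dot3_def algebra_simps)

lemma outer_eq_scaleD:
  fixes v f w g :: "'a::field ^ 3"
  assumes "outer v f = mat c ** outer w g" "v \<noteq> 0" "f \<noteq> 0"
  shows "\<exists>a. v = a *s w" "\<exists>b. f = b *s g"
proof -
  obtain i j where ij: "v $ i \<noteq> 0" "f $ j \<noteq> 0" using assms by (auto simp: vec_eq_iff)
  have e: "v$k * f$l = c * (w$k * g$l)" for k l
    using assms(1) by (auto simp: vec_eq_iff outer_def mat_mult_nth)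
  have "v$k = (c * g$j / f$j) * w$k" for k using ij e[of k j] by (simp add: field_simps)
  then have "v = (c * g$j / f$j) *s w" by (simp add: vec_eq_iff)
  moreover have "f$l = (c * w$i / v$i) * g$l" for l using ij e[of i l] by (simp add: field_simps)
  then have "f = (c * w$i / v$i) *s g" by (simp add: vec_eq_iff)
  ultimately show "\<exists>a. v = a *s w" "\<exists>b. f = b *s g" by blast+
qed

text \<open>All rows are multiples of one nonzero row, which serves as \<open>f\<close>; the
  coefficients form \<open>v\<close>.\<close>

lemma rank_oneE:
  fixes A :: "'a::field ^ 3 ^ 3"
  assumes "A \<noteq> 0" "cross (A$1) (A$2) = 0" "cross (A$2) (A$3) = 0" "cross (A$3) (A$1) = 0"
  obtains v f where "A = outer v f" "v \<noteq> 0" "f \<noteq> 0"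
proof -
  obtain k where k: "A $ k \<noteq> 0" using \<open>A \<noteq> 0\<close> by (auto simp: vec_eq_iff)
  have "cross (A$k) (A$i) = 0" for i
    using assms(2-) exhaust_3[of i] exhaust_3[of k] by (metis cross_eq_0_commute cross_refl)
  then have "\<exists>c. A$i = c *s A$k" for i using k cross_eq_0D by metis
  then obtain c where "\<And>i. A$i = c i *s A$k" by metis
  then have "A = outer (\<chi> i. c i) (A$k)"
    by (metis (no_types, lifting) outer_def vec_eq_iff vec_lambda_beta vector_smult_component)
  moreover from this have "(\<chi> i. c i) \<noteq> 0" using \<open>A \<noteq> 0\<close> by (metis outer_eq_0_iff)
  ultimately show ?thesis using k that by blast
qed

text \<open>Each column of \<open>B\<close> is killed by two independent rows of \<open>A\<close>,
  hence is a multiple of their cross product.\<close>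

lemma matrix_kernelE:
  fixes A B :: "'a::field ^ 3 ^ 3"
  assumes "cross (A$i) (A$j) \<noteq> 0" "A ** B = 0"
  obtains a where "B = outer (cross (A$i) (A$j)) a"
proof -
  have "dot3 (A$k) (column l B) = 0" for k l
    using assms(2) by (simp add: dot3_def column_def vec_eq_iff matrix_matrix_mult_def sum_3)
  then have "\<exists>c. column l B = c *s cross (A$i) (A$j)" for l
    using assms(1) orthogonal_pairE by metis
  then obtain a where a: "\<And>l. column l B = a l *s cross (A$i) (A$j)" by metis
  have "B $ k $ l = cross (A$i) (A$j) $ k * a l" for k l
    using a[of l] by (metis column_def mult.commute vec_lambda_beta vector_smult_component)
  then have "B = outer (cross (A$i) (A$j)) (\<chi> l. a l)"
    by (simp add: outer_def vec_eq_iff)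
  then show ?thesis by (rule that)
qed

section \<open>The matrix model\<close>

text \<open>The entry in row \<open>r\<close> and column \<open>s\<close>, counted from 0, is the sum over \<open>i\<close> of
  \<open>w ^ (2 * i * (r + s)) * x\<^bsub>i,s-r\<^esub>\<close>; the inverse map is a discrete Fourier transform.\<close>

definition to_mat :: "'a::field \<Rightarrow> 'a okubo \<Rightarrow> 'a ^ 3 ^ 3" where
  "to_mat w x = vector [
     vector [x$I10 + x$I20, x$I01 + w^2 * x$I11 + w * x$I21, x$I02 + w * x$I12 + w^2 * x$I22],
     vector [x$I02 + w^2 * x$I12 + w * x$I22, w * x$I10 + w^2 * x$I20, x$I01 + x$I11 + x$I21],
     vector [x$I01 + w * x$I11 + w^2 * x$I21, x$I02 + x$I12 + x$I22, w^2 * x$I10 + w * x$I20]]"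

definition of_mat :: "'a::field \<Rightarrow> 'a ^ 3 ^ 3 \<Rightarrow> 'a okubo" where
  "of_mat w A = (\<chi> i. (case i of
       I10 \<Rightarrow> A$1$1 + w^2 * A$2$2 + w * A$3$3
     | I20 \<Rightarrow> A$1$1 + w * A$2$2 + w^2 * A$3$3
     | I01 \<Rightarrow> A$1$2 + A$2$3 + A$3$1
     | I11 \<Rightarrow> w * A$1$2 + A$2$3 + w^2 * A$3$1
     | I21 \<Rightarrow> w^2 * A$1$2 + A$2$3 + w * A$3$1
     | I02 \<Rightarrow> A$1$3 + A$2$1 + A$3$2
     | I12 \<Rightarrow> w^2 * A$1$3 + w * A$2$1 + A$3$2
     | I22 \<Rightarrow> w * A$1$3 + w^2 * A$2$1 + A$3$2) / 3)"

locale cube_root =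
  fixes w :: "'a::field"
  assumes w2: "w\<^sup>2 = - 1 - w" and three: "(3 :: 'a) \<noteq> 0"
begin

text \<open>Rewrite rules that reduce polynomials in \<open>w\<close> to degree one; the second
  catches the right-nested products left by \<open>algebra_simps\<close>.\<close>

lemma ww: "w * w = - 1 - w" "w * (w * z) = - z - w * z"
proof -
  show *: "w * w = - 1 - w" using w2 by (simp add: power2_eq_square)
  have "w * (w * z) = (w * w) * z" by (simp only: mult.assoc)
  then show "w * (w * z) = - z - w * z" by (simp add: * left_diff_distrib)
qed

text \<open>The difference equals \<open>2 * w + 1\<close>, whose square is the discriminant -3 of
  the quadratic equation of \<open>w\<close>.\<close>

lemma w_diff: "w - w\<^sup>2 \<noteq> 0"
proof
  assume "w - w\<^sup>2 = 0"
  then have "2 * w + 1 = 0" by (simp add: w2)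
  then have "(2 * w + 1) * (2 * w + 1) = 0" by simp
  then have "(3 :: 'a) = 0" by (simp add: algebra_simps ww)
  with three show False by simp
qed

lemma trace_to_mat: "trace (to_mat w x) = 0"
  by (simp add: trace_def sum_3 to_mat_def w2 algebra_simps)

lemma of_mat_to_mat [simp]: "of_mat w (to_mat w x) = x"
  unfolding vec_eq_iff forall_okubo_index
  using three by (simp add: to_mat_def of_mat_def ww power2_eq_square divide_simps)
      (simp add: algebra_simps ww)

text \<open>The trace is the Fourier coefficient with subscript 0,0, for which there is no basis
  element; hence the restriction to trace zero.\<close>

lemma to_mat_of_mat:
  assumes "trace A = 0"
  shows "to_mat w (of_mat w A) = A"
proof -
  have "A$1$1 + A$2$2 + A$3$3 = 0"
    using assms by (simp add: trace_def sum_3)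
  then have "A$3$3 = - (A$1$1 + A$2$2)" by (simp only: add_eq_0_iff)
  \<comment> \<open>Powers of 3 have to be nonzero for the clearing of denominators below.\<close>
  moreover have "(9 :: 'a) = 3 * 3" by simp
  then have nine: "(9 :: 'a) \<noteq> 0" using three by (metis mult_eq_0_iff)
  moreover have "(27 :: 'a) = 9 * 3" by simp
  then have "(27 :: 'a) \<noteq> 0" using three nine by (metis mult_eq_0_iff)
  ultimately show ?thesis
    unfolding vec_eq_iff forall_3
    using three by (simp add: to_mat_def of_mat_def ww power2_eq_square divide_simps)
      (simp add: algebra_simps ww)
qed

lemma to_mat_scale: "to_mat w (c *s x) = mat c ** to_mat w x"
  by (simp add: vec_eq_iff forall_3 mat_mult_nth to_mat_def algebra_simps)

text \<open>Okubo's product \<open>(w X Y - w^2 Y X) / (w - w^2) - tr (X Y) / 3\<close>, multiplied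
  by its denominators and stated entry by entry.\<close>

lemma to_mat_mult:
  "3 * (w - w\<^sup>2) * to_mat w (x \<star> y) $ i $ j =
   3 * w * (to_mat w x ** to_mat w y) $ i $ j - 3 * w\<^sup>2 * (to_mat w y ** to_mat w x) $ i $ j
   - (w - w\<^sup>2) * mat (trace (to_mat w x ** to_mat w y)) $ i $ j" (is "?P i j")
proof -
  have "\<forall>i j. ?P i j"
    unfolding forall_3
    by (simp add: to_mat_def okubo_mult_nth matrix_matrix_mult_def trace_def sum_3 mat_def
      algebra_simps power2_eq_square ww)
  then show ?thesis by blast
qed

text \<open>The cross products of the rows are the columns of the adjugate.\<close>

lemma cross_to_mat:
  "cross (to_mat w x $ 2) (to_mat w x $ 3) = (\<chi> i. to_mat w (x \<star> x) $ i $ 1 - okubo_norm x * mat 1 $ i $ 1)"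
  "cross (to_mat w x $ 3) (to_mat w x $ 1) = (\<chi> i. to_mat w (x \<star> x) $ i $ 2 - okubo_norm x * mat 1 $ i $ 2)"
  "cross (to_mat w x $ 1) (to_mat w x $ 2) = (\<chi> i. to_mat w (x \<star> x) $ i $ 3 - okubo_norm x * mat 1 $ i $ 3)"
  by (simp_all add: vec_eq_iff forall_3 cross_def to_mat_def okubo_mult_nth okubo_norm_def mat_def
    algebra_simps power2_eq_square ww)

section \<open>Orthogonality and squares of zero in terms of matrices\<close>

lemma to_mat_eq_0_iff: "to_mat w x = 0 \<longleftrightarrow> x = 0"
proof -
  have "to_mat w 0 = 0"
    by (simp add: to_mat_def vec_eq_iff forall_3)
  then show ?thesis by (metis of_mat_to_mat)
qed

text \<open>The two vanishing products are linear equations in \<open>X Y\<close> and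
  \<open>Y X\<close>, which have the same trace \<open>t\<close>. Subtracting them gives
  \<open>X Y = Y X\<close>; either one then gives \<open>3 X Y = t\<close>. For the converse, the
  scalar matrix of \<open>l\<close> has trace \<open>3 * l\<close>, and all terms cancel.\<close>

lemma orth_iff:
  "orth x y \<longleftrightarrow>
     (\<exists>l. to_mat w x ** to_mat w y = mat l \<and> to_mat w y ** to_mat w x = mat l)"
  (is "_ \<longleftrightarrow> (\<exists>l. ?P = mat l \<and> ?Q = mat l)")
proof
  assume "orth x y"
  then have 0: "to_mat w (x \<star> y) $ i $ j = 0" "to_mat w (y \<star> x) $ i $ j = 0" for i j
    using to_mat_eq_0_iff[of 0] by (simp_all add: orth_def)
  define t where "t = trace ?P"
  have t: "trace ?Q = t" unfolding t_def by (rule trace_mul_sym)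
  have P: "3 * w * ?P $ i $ j - 3 * w\<^sup>2 * ?Q $ i $ j - (w - w\<^sup>2) * mat t $ i $ j = 0"
    and Q: "3 * w * ?Q $ i $ j - 3 * w\<^sup>2 * ?P $ i $ j - (w - w\<^sup>2) * mat t $ i $ j = 0" for i j
    using to_mat_mult[of x y i j] to_mat_mult[of y x i j]
    unfolding 0 t t_def[symmetric] mult_zero_right by simp_all
  have "3 * (?Q $ i $ j - ?P $ i $ j) = 0" for i j
  proof -
    \<comment> \<open>The coefficients combine because \<open>w + w^2 = - 1\<close>.\<close>
    have "3 * (?Q $ i $ j - ?P $ i $ j) =
      (3 * w * ?P $ i $ j - 3 * w\<^sup>2 * ?Q $ i $ j - (w - w\<^sup>2) * mat t $ i $ j)
     - (3 * w * ?Q $ i $ j - 3 * w\<^sup>2 * ?P $ i $ j - (w - w\<^sup>2) * mat t $ i $ j)"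
      by (simp add: algebra_simps w2)
    then show ?thesis by (simp only: P Q) simp
  qed
  then have QP: "?Q $ i $ j = ?P $ i $ j" for i j using three by simp
  have "?P $ i $ j = mat (t / 3) $ i $ j" for i j
  proof -
    have "(w - w\<^sup>2) * (3 * ?P $ i $ j - mat t $ i $ j) = 0"
      using P[of i j] by (simp add: QP algebra_simps)
    then have "3 * ?P $ i $ j = mat t $ i $ j" using w_diff by simp
    then show ?thesis using three by (auto simp: mat_def field_simps)
  qed
  then show "\<exists>l. ?P = mat l \<and> ?Q = mat l"
    by (intro exI[of _ "t / 3"]) (simp add: vec_eq_iff QP)
next
  assume "\<exists>l. ?P = mat l \<and> ?Q = mat l"
  then obtain l where l: "?P = mat l" "?Q = mat l" by blast
  have t: "trace (mat l :: 'a ^ 3 ^ 3) = 3 * l"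
    by (simp add: trace_def mat_def)
  have "3 * (w - w\<^sup>2) * to_mat w (x \<star> y) $ i $ j = 0" for i j
    unfolding to_mat_mult l t by (simp add: mat_def algebra_simps)
  then have "to_mat w (x \<star> y) = 0" using three w_diff by (simp add: vec_eq_iff)
  moreover have "3 * (w - w\<^sup>2) * to_mat w (y \<star> x) $ i $ j = 0" for i j
    unfolding to_mat_mult l t by (simp add: mat_def algebra_simps)
  then have "to_mat w (y \<star> x) = 0" using three w_diff by (simp add: vec_eq_iff)
  ultimately show "orth x y" by (simp add: orth_def to_mat_eq_0_iff)
qed

text \<open>Square zero forces norm zero, so the adjugate vanishes and the nonzero matrix has rank
  one. Trace zero then says that \<open>f\<close> vanishes at \<open>v\<close>.\<close>

lemma flagE:
  fixes x :: "'a okubo"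
  assumes "x \<noteq> 0" "x \<star> x = 0"
  obtains v f where "x = of_mat w (outer v f)" "v \<noteq> 0" "f \<noteq> 0" "dot3 f v = 0"
proof -
  have "okubo_norm x *s x = 0" using okubo_mult_left[of x x] assms by simp
  then have "okubo_norm x = 0" using assms by simp
  then have c: "cross (to_mat w x $ 2) (to_mat w x $ 3) = 0"
     "cross (to_mat w x $ 3) (to_mat w x $ 1) = 0"
     "cross (to_mat w x $ 1) (to_mat w x $ 2) = 0"
    using to_mat_eq_0_iff[of "x \<star> x"] by (simp_all add: cross_to_mat assms vec_eq_iff)
  have "to_mat w x \<noteq> 0" using assms by (simp add: to_mat_eq_0_iff)
  then obtain v f where vf: "to_mat w x = outer v f" "v \<noteq> 0" "f \<noteq> 0"
    using c by (rule_tac rank_oneE)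
  moreover have "dot3 f v = 0" using trace_to_mat[of x] by (simp add: vf trace_outer)
  ultimately show ?thesis using that of_mat_to_mat by metis
qed

text \<open>The independent rows and columns give \<open>X\<close> rank at least two. A matrix
  annihilating \<open>X\<close> from both sides has its columns in the right kernel of
  \<open>X\<close> and its rows in the left kernel, both at most one-dimensional, so all such
  matrices are multiples of \<open>S\<close>. The lemma is applied to a nilpotent \<open>X\<close>
  of rank two, with its adjugate as \<open>S\<close>.\<close>

lemma nilpotent_neighbour:
  fixes X Z S :: "'a ^ 3 ^ 3"
  assumes "cross (X$i) (X$j) \<noteq> 0" "cross (transpose X $ k) (transpose X $ l) \<noteq> 0"
    and "X ** Z = 0" "Z ** X = 0" "X ** S = 0" "S ** X = 0" "S \<noteq> 0"
  shows "\<exists>c. Z = mat c ** S"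
proof -
  let ?u = "cross (X$i) (X$j)" and ?u' = "cross (transpose X $ k) (transpose X $ l)"
  have *: "\<exists>c. A = outer (c *s ?u) ?u'" if A: "X ** A = 0" "A ** X = 0" for A
  proof -
    obtain a where a: "A = outer ?u a" using matrix_kernelE assms(1) A(1) by metis
    have "transpose X ** transpose A = transpose (A ** X)" by (simp only: matrix_transpose_mul)
    also have "\<dots> = 0" by (simp add: A(2) transpose_def vec_eq_iff)
    finally obtain b where "transpose A = outer ?u' b" using matrix_kernelE assms(2) by metis
    then have b: "A = outer b ?u'"
      by (simp add: transpose_def outer_def vec_eq_iff mult.commute)
    show ?thesis
    proof (cases "A = 0")
      case True
      then show ?thesis by (intro exI[of _ 0]) (simp add: outer_def vec_eq_iff)
    next
      case False
      then have "b \<noteq> 0" by (simp add: b outer_eq_0_iff)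
      moreover have "outer b ?u' = mat 1 ** outer ?u a" using a b by simp
      ultimately show ?thesis using outer_eq_scaleD(1) assms(2) b by metis
    qed
  qed
  obtain c where c: "Z = outer (c *s ?u) ?u'" using * assms by blast
  obtain d where d: "S = outer (d *s ?u) ?u'" using * assms by blast
  then have "d \<noteq> 0" using \<open>S \<noteq> 0\<close> by (auto simp: outer_eq_0_iff)
  then have "Z = mat (c / d) ** S"
    by (simp add: c d vec_eq_iff mat_mult_nth outer_def)
  then show ?thesis by blast
qed

text \<open>Evaluating \<open>S X Z\<close> in two ways gives \<open>d Z = l S\<close>, where
  \<open>S\<close> is the adjugate of \<open>X\<close>. If \<open>d\<close> is nonzero, this already
  makes \<open>Z\<close> a multiple of \<open>S\<close>. If \<open>d = 0\<close>, then
  \<open>l = 0\<close> and \<open>Z\<close> annihilates \<open>X\<close> from both sides.\<close>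

lemma orth_square_unique:
  fixes x z :: "'a okubo"
  assumes "okubo_norm x = 0" "x \<star> x \<noteq> 0" "orth x z"
  shows "\<exists>c. z = c *s (x \<star> x)"
proof -
  let ?X = "to_mat w x" and ?Z = "to_mat w z" and ?S = "to_mat w (x \<star> x)"
  have S0: "?S \<noteq> 0" using assms by (simp add: to_mat_eq_0_iff)
  obtain l where l: "?X ** ?Z = mat l" "?Z ** ?X = mat l"
    using orth_iff assms by blast
  have "orth x (x \<star> x)"
    by (simp add: orth_def okubo_mult_left okubo_mult_right assms)
  then obtain d where d: "?X ** ?S = mat d" "?S ** ?X = mat d" \<comment> \<open>\<open>d\<close> is the determinant of \<open>X\<close>\<close>
    using orth_iff by blast
  have ld: "mat d ** ?Z = mat l ** ?S"
  proof -
    have "mat d ** ?Z = ?S ** (?X ** ?Z)" by (simp add: d matrix_mul_assoc)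
    also have "\<dots> = mat l ** ?S"
      by (simp add: l vec_eq_iff mat_mult_nth mult_mat_nth mult.commute)
    finally show ?thesis .
  qed
  have "\<exists>c. ?Z = mat c ** ?S"
  proof (cases "d = 0")
    case False
    have "d * ?Z $ i $ j = l * ?S $ i $ j" for i j
      using ld by (metis mat_mult_nth)
    then have "?Z $ i $ j = l / d * ?S $ i $ j" for i j
      using False by (simp add: field_simps)
    then have "?Z = mat (l / d) ** ?S" by (simp add: vec_eq_iff mat_mult_nth)
    then show ?thesis by blast
  next
    case True
    have "l * ?S $ i $ j = 0" for i j
      using ld True by (metis mat_mult_nth mult_zero_left)
    with S0 have "l = 0" by (auto simp: vec_eq_iff)
    \<comment> \<open>The columns of the adjugate are cross products of rows of \<open>X\<close>,
      and its rows are cross products of columns of \<open>X\<close>. One nonzero entry of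
      \<open>S\<close> therefore yields both an independent pair of rows and one of columns.\<close>
    have S: "column 1 ?S = cross (?X$2) (?X$3)" "column 2 ?S = cross (?X$3) (?X$1)"
      "column 3 ?S = cross (?X$1) (?X$2)"
      by (simp_all add: cross_to_mat assms column_def)
    have S': "?S $ 1 = cross (transpose ?X$2) (transpose ?X$3)"
      "?S$2 = cross (transpose ?X$3) (transpose ?X$1)" "?S$3 = cross (transpose ?X$1) (transpose ?X$2)"
      using S by (auto simp: vec_eq_iff forall_3 column_def transpose_def cross_def algebra_simps)
    obtain i j where ij: "?S $ i $ j \<noteq> 0" using S0 by (auto simp: vec_eq_iff)
    then have "column j ?S \<noteq> 0" "?S $ i \<noteq> 0" by (auto simp: vec_eq_iff column_def)
    then obtain p q p' q' where "cross (?X $ p) (?X $ q) \<noteq> 0" "cross (transpose ?X $ p') (transpose ?X $ q') \<noteq> 0"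
      using S S' exhaust_3[of i] exhaust_3[of j] by metis
    moreover have "mat 0 = (0 :: 'a ^ 3 ^ 3)" by (simp add: vec_eq_iff mat_def)
    ultimately show ?thesis
      using nilpotent_neighbour l d True \<open>l = 0\<close> S0 by metis
  qed
  then obtain c where "?Z = to_mat w (c *s (x \<star> x))" by (auto simp: to_mat_scale)
  then show ?thesis by (metis of_mat_to_mat)
qed

end

section \<open>Walks of minimal length\<close>

text \<open>Walks rather than paths, since they can be split at their first arc without a condition
  on repeated vertices. At minimal length the two notions agree, by
  \<open>paths_of_length_eq_walks\<close>.\<close>

definition walks :: "'v pair_pre_digraph \<Rightarrow> 'v \<Rightarrow> nat \<Rightarrow> 'v \<Rightarrow> ('v \<times> 'v) awalk set" where
  "walks G u k v = {p. pre_digraph.awalk (with_proj G) u p v \<and> length p = k}"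

definition at_distance :: "'v pair_pre_digraph \<Rightarrow> 'v \<Rightarrow> nat \<Rightarrow> 'v \<Rightarrow> bool" where
  "at_distance G u k v \<longleftrightarrow> walks G u k v \<noteq> {} \<and> (\<forall>j<k. walks G u j v = {})"

lemma walks_0: "walks G u 0 v = (if u = v \<and> u \<in> pverts G then {[]} else {})"
  by (auto simp: walks_def pre_digraph.awalk_def pre_digraph.cas.simps)

lemma walks_Suc:
  assumes "wf_digraph (with_proj G)"
  shows "walks G u (Suc k) v = (\<Union>z\<in>{z. (u, z) \<in> parcs G}. (#) (u, z) ` walks G z k v)"
  by (auto simp: walks_def wf_digraph.awalk_Cons_iff[OF assms] length_Suc_conv image_iff)

lemma walks_1:
  assumes "wf_digraph (with_proj G)"
  shows "walks G u (Suc 0) v = (if (u, v) \<in> parcs G then {[(u, v)]} else {})"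
proof -
  have "v \<in> pverts G" if "(u, v) \<in> parcs G"
    using wf_digraph.head_in_verts[OF assms, of "(u, v)"] that by simp
  then show ?thesis by (auto simp: walks_Suc[OF assms] walks_0 split: if_splits)
qed

lemma walks_2:
  assumes "wf_digraph (with_proj G)"
  shows "walks G u (Suc (Suc 0)) v = {[(u, z), (z, v)] | z. (u, z) \<in> parcs G \<and> (z, v) \<in> parcs G}"
  unfolding walks_Suc[OF assms, of u "Suc 0"] walks_1[OF assms] by (auto split: if_splits)

lemma walks_3:
  assumes "wf_digraph (with_proj G)"
  shows "walks G u (Suc (Suc (Suc 0))) v = {[(u, z), (z, z'), (z', v)] | z z'.
    (u, z) \<in> parcs G \<and> (z, z') \<in> parcs G \<and> (z', v) \<in> parcs G}"
  unfolding walks_Suc[OF assms, of u "Suc (Suc 0)"] walks_2[OF assms] by blast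

lemma at_distance_unique: "at_distance G u j v \<Longrightarrow> at_distance G u k v \<Longrightarrow> j = k"
  unfolding at_distance_def by (meson linorder_neqE_nat)

text \<open>The distance is an infimum of walk lengths. It is attained: if no walk had length
  \<open>k\<close>, all would have length at least \<open>Suc k\<close>, and so would the
  infimum.\<close>

lemma at_distance_graph_distance:
  assumes "wf_digraph (with_proj G)" "graph_distance G u v = ereal (real k)"
  shows "at_distance G u k v"
proof -
  interpret wf_digraph "with_proj G" by fact
  have cost: "awalk_cost (\<lambda>_. 1) p = real (length p)" for p
    by (simp add: awalk_cost_def sum_list_triv)
  have le: "k \<le> length p" if "awalk u p v" for p
    using min_cost_le_walk_cost[OF that, of "\<lambda>_. 1"] assms(2) by (simp add: graph_distance_def cost)
  have "walks G u k v \<noteq> {}"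
  proof
    assume empty: "walks G u k v = {}"
    have "ereal (real (Suc k)) \<le> \<mu> (\<lambda>_. 1) u v"
      unfolding \<mu>_def
    proof (rule INF_greatest)
      fix p assume "p \<in> {p. awalk u p v}"
      then have "awalk u p v" by simp
      then have "length p \<noteq> k" using empty by (auto simp: walks_def)
      with le[OF \<open>awalk u p v\<close>] have "Suc k \<le> length p" by simp
      then show "ereal (real (Suc k)) \<le> ereal (awalk_cost (\<lambda>_. 1) p)"
        unfolding cost ereal_less_eq of_nat_le_iff .
    qed
    then show False using assms(2) by (simp add: graph_distance_def)
  qed
  moreover have "walks G u j v = {}" if "j < k" for j
    using le that by (fastforce simp: walks_def)
  ultimately show ?thesis by (simp add: at_distance_def)
qed

text \<open>Cutting out the loop at a repeated vertex would leave a walk shorter than the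
  distance.\<close>

lemma paths_of_length_eq_walks:
  assumes "wf_digraph (with_proj G)" "at_distance G u k v"
  shows "paths_of_length G u v k = walks G u k v"
proof -
  interpret wf_digraph "with_proj G" by fact
  have "distinct (awalk_verts u p)" if p: "awalk u p v" "length p = k" for p
  proof (rule ccontr)
    assume "\<not> distinct (awalk_verts u p)"
    then obtain q r s z where "p = q @ r @ s" "0 < length r" "awalk u q z" "awalk z s v"
      using awalk_not_distinct_decomp[OF p(1)] by blast
    then have "q @ s \<in> walks G u (length (q @ s)) v" "length (q @ s) < k"
      using p(2) awalk_appendI by (auto simp: walks_def)
    then show False using assms(2) by (auto simp: at_distance_def)
  qed
  then show ?thesis by (auto simp: paths_of_length_def walks_def apath_def)
qed

text \<open>Every nonempty walk from \<open>u\<close> begins with the forced arc to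
  \<open>u'\<close>, and deleting it is a bijection onto the walks from \<open>u'\<close> that are
  shorter by one.\<close>

lemma sole_neighbour:
  assumes "wf_digraph (with_proj G)" "at_distance G u (Suc k) v"
    and sole: "\<And>z. (u, z) \<in> parcs G \<Longrightarrow> z = u'"
  shows "at_distance G u' k v" "card (walks G u (Suc k) v) = card (walks G u' k v)"
proof -
  note Suc = walks_Suc[OF assms(1)]
  have "(u, u') \<in> parcs G" using assms(2) sole unfolding at_distance_def Suc by blast
  then have "{z. (u, z) \<in> parcs G} = {u'}" using sole by blast
  then have step: "walks G u (Suc j) v = (#) (u, u') ` walks G u' j v" for j
    unfolding Suc by simp
  show "card (walks G u (Suc k) v) = card (walks G u' k v)"
    unfolding step by (intro card_image) simp
  have "walks G u' j v = {}" if "j < k" for j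
    using assms(2) step[of j] that unfolding at_distance_def by (metis Suc_less_eq image_is_empty)
  then show "at_distance G u' k v"
    using assms(2) step[of k] by (auto simp: at_distance_def)
qed

section \<open>Reversal of walks\<close>

lemma walks_reverse:
  assumes "wf_digraph (with_proj G)" "symmetric (with_proj G)" "p \<in> walks G u k v"
  shows "rev (map prod.swap p) \<in> walks G v k u"
  using assms(3)
proof (induction k arbitrary: u p)
  case 0
  then show ?case by (auto simp: walks_0 split: if_splits)
next
  case (Suc k)
  interpret wf_digraph "with_proj G" by fact
  obtain z q where p: "p = (u, z) # q" "(u, z) \<in> parcs G" "q \<in> walks G z k v"
    using Suc.prems by (auto simp: walks_Suc[OF assms(1)])
  have "(z, u) \<in> parcs G" using assms(2) p(2) by (auto simp: symmetric_def dest: symD)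
  then have "awalk z [(z, u)] u" using arc_implies_awalk[of "(z, u)"] by simp
  then show ?case using Suc.IH[OF p(3)] p by (auto simp: walks_def intro: awalk_appendI)
qed

lemma card_walks_commute:
  assumes "wf_digraph (with_proj G)" "symmetric (with_proj G)"
  shows "card (walks G u k v) = card (walks G v k u)"
  by (rule bij_betw_same_card[of "\<lambda>p. rev (map prod.swap p)"],
      rule bij_betw_byWitness[where f' = "\<lambda>p. rev (map prod.swap p)"])
    (use walks_reverse[OF assms] in \<open>auto simp: rev_map\<close>)

lemma at_distance_commute:
  assumes "wf_digraph (with_proj G)" "symmetric (with_proj G)" "at_distance G u k v"
  shows "at_distance G v k u"
  using assms(3) walks_reverse[OF assms(1,2)] unfolding at_distance_def by blast

section \<open>Geodesics in the orthogonality graph\<close>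

abbreviation (input) "\<Gamma> \<equiv> orthogonality_graph"

lemma line_eq_iff:
  assumes "x \<noteq> 0"
  shows "line x = line y \<longleftrightarrow> (\<exists>c. c \<noteq> 0 \<and> x = c *s y)"
proof
  assume "line x = line y"
  moreover have "x \<in> line x" unfolding line_def by (rule range_eqI[of _ _ 1]) simp
  ultimately obtain c where "x = c *s y" by (auto simp: line_def)
  with assms show "\<exists>c. c \<noteq> 0 \<and> x = c *s y" by auto
next
  assume "\<exists>c. c \<noteq> 0 \<and> x = c *s y"
  then obtain c where "c \<noteq> 0" "x = c *s y" by blast
  then have xy: "a *s y = (a / c) *s x" "a *s x = (a * c) *s y" for a
    by simp_all
  show "line x = line y" unfolding line_def
  proof (intro equalityI image_subsetI)
    show "a *s x \<in> range (\<lambda>c. c *s y)" for a using xy(2) by (rule range_eqI)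
    show "a *s y \<in> range (\<lambda>c. c *s x)" for a using xy(1) by (rule range_eqI)
  qed
qed

lemma orth_scale: "c \<noteq> 0 \<Longrightarrow> d \<noteq> 0 \<Longrightarrow> orth (c *s x) (d *s y) \<longleftrightarrow> orth x y"
  by (simp add: orth_def okubo_mult_scale)

abbreviation vertex :: "'a::field okubo \<Rightarrow> bool" where
  "vertex x \<equiv> x \<in> two_sided_zero_divisors"

text \<open>The arcs are defined through some representatives of the lines; as \<open>orth\<close>
  is invariant under nonzero scaling, any representatives will do.\<close>

lemma arc_iff:
  assumes "vertex x" "vertex y"
  shows "(line x, line y) \<in> parcs \<Gamma> \<longleftrightarrow> line x \<noteq> line y \<and> orth x y"
proof
  assume "(line x, line y) \<in> parcs \<Gamma>"
  then obtain a b where "line x = line a" "line y = line b" "line a \<noteq> line b" "orth a b"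
    by (auto simp: orthogonality_graph_def orth_def)
  moreover from this obtain c d where "c \<noteq> 0" "x = c *s a" "d \<noteq> 0" "y = d *s b"
    using assms line_eq_iff[of x a] line_eq_iff[of y b] by (auto simp: zero_divisor_iff)
  ultimately show "line x \<noteq> line y \<and> orth x y" using orth_scale by metis
next
  assume "line x \<noteq> line y \<and> orth x y"
  then show "(line x, line y) \<in> parcs \<Gamma>"
    using assms by (auto simp: orthogonality_graph_def orth_def)
qed

lemma arcE:
  assumes "(u, z) \<in> parcs \<Gamma>"
  obtains x y where "u = line x" "z = line y" "vertex x" "vertex y"
  using assms by (auto simp: orthogonality_graph_def)

lemma vertex_square: "vertex x \<Longrightarrow> x \<star> x \<noteq> 0 \<Longrightarrow> vertex (x \<star> x)"
proof -
  assume x: "vertex x" "x \<star> x \<noteq> 0"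
  then have "x \<star> (x \<star> x) = 0" by (simp add: zero_divisor_iff okubo_mult_left)
  with x have "x \<star> x \<in> zero_divisors" by (auto simp: zero_divisors_def zero_divisor_iff(2))
  then show ?thesis by (simp add: zero_divisor_iff)
qed

section \<open>Flags: a point \<open>v\<close> on a line \<open>f\<close> of the projective plane,
  in homogeneous coordinates\<close>

definition flag :: "'a::field ^ 3 \<Rightarrow> 'a ^ 3 \<Rightarrow> bool" where
  "flag v f \<longleftrightarrow> v \<noteq> 0 \<and> f \<noteq> 0 \<and> dot3 f v = 0"

text \<open>If the points or the lines of the two flags coincided, both mixed incidences would
  hold.\<close>

lemma flag_cross:
  fixes v w f g :: "'a::field ^ 3"
  assumes "flag v f" "flag w g" "dot3 f w \<noteq> 0 \<or> dot3 g v \<noteq> 0"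
  shows "cross v w \<noteq> 0" "cross f g \<noteq> 0"
proof -
  have f: "v \<noteq> 0" "f \<noteq> 0" "dot3 f v = 0" "w \<noteq> 0" "g \<noteq> 0" "dot3 g w = 0"
    using assms by (auto simp: flag_def)
  show "cross v w \<noteq> 0"
  proof
    assume "cross v w = 0"
    then obtain c where "w = c *s v" using cross_eq_0D f by metis
    with f assms(3) show False by auto
  qed
  show "cross f g \<noteq> 0"
  proof
    assume "cross f g = 0"
    then obtain c where "g = c *s f" using cross_eq_0D f by metis
    with f assms(3) show False by auto
  qed
qed

text \<open>If the points differ, both lines pass through both points and hence equal the line
  \<open>cross v w\<close> joining them.\<close>

lemma common_point_or_line:
  fixes v w f g :: "'a::field ^ 3"
  assumes "flag v f" "flag w g" "dot3 f w = 0" "dot3 g v = 0"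
  shows "(\<exists>c. w = c *s v) \<or> (\<exists>c. g = c *s f)"
proof (cases "cross v w = 0")
  case True
  then show ?thesis using cross_eq_0D assms(1) unfolding flag_def by metis
next
  case False
  have f: "f \<noteq> 0" "dot3 v f = 0" "dot3 w g = 0" "dot3 w f = 0" "dot3 v g = 0"
    using assms by (simp_all add: flag_def dot3_commute)
  obtain c where c: "f = c *s cross v w" using orthogonal_pairE False f by metis
  obtain d where d: "g = d *s cross v w" using orthogonal_pairE False f by metis
  have "c \<noteq> 0" using f c by auto
  then have "g = (d / c) *s f" using c d by simp
  then show ?thesis by blast
qed

context cube_root
begin

section \<open>Flags as vertices of the orthogonality graph\<close>

definition flag_line :: "'a ^ 3 \<Rightarrow> 'a ^ 3 \<Rightarrow> 'a okubo set" where
  "flag_line v f = line (of_mat w (outer v f))"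

lemma to_mat_flag: "dot3 f v = 0 \<Longrightarrow> to_mat w (of_mat w (outer v f)) = outer v f"
  by (simp add: to_mat_of_mat trace_outer)

lemma of_mat_scale: "trace A = 0 \<Longrightarrow> of_mat w (mat c ** A) = c *s of_mat w A"
  by (metis of_mat_to_mat to_mat_of_mat to_mat_scale)

lemma of_mat_outer_ne_0: "flag v f \<Longrightarrow> of_mat w (outer v f) \<noteq> 0"
  by (metis flag_def outer_eq_0_iff to_mat_eq_0_iff to_mat_flag)

text \<open>Since \<open>f\<close> vanishes at \<open>v\<close>, the matrix \<open>A\<close> of the
  first flag has square zero; multiplying \<open>A B = l\<close> by \<open>A\<close> gives
  \<open>l A = 0\<close>, so \<open>l = 0\<close>. The products \<open>A B\<close> and
  \<open>B A\<close> are the two mixed pairings times nonzero rank-one matrices.\<close>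

lemma orth_flag:
  assumes "flag v f" "flag v' f'"
  shows "orth (of_mat w (outer v f)) (of_mat w (outer v' f')) \<longleftrightarrow> dot3 f v' = 0 \<and> dot3 f' v = 0"
proof -
  have f: "v \<noteq> 0" "f \<noteq> 0" "dot3 f v = 0" "v' \<noteq> 0" "f' \<noteq> 0" "dot3 f' v' = 0"
    using assms by (auto simp: flag_def)
  have mat0: "mat 0 ** A = 0" for A :: "'a ^ 3 ^ 3"
    by (simp add: vec_eq_iff mat_mult_nth)
  have mat_0: "mat 0 = (0 :: 'a ^ 3 ^ 3)" by (simp add: vec_eq_iff mat_def)
  let ?A = "outer v f" and ?B = "outer v' f'"
  have *: "orth (of_mat w ?A) (of_mat w ?B) \<longleftrightarrow> (\<exists>l. ?A ** ?B = mat l \<and> ?B ** ?A = mat l)"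
    unfolding orth_iff using f by (simp add: to_mat_flag)
  show ?thesis
  proof
    assume "orth (of_mat w ?A) (of_mat w ?B)"
    then obtain l where l: "?A ** ?B = mat l" "?B ** ?A = mat l" using * by blast
    have "?A ** mat l = (?A ** ?A) ** ?B" by (simp add: l(1)[symmetric] matrix_mul_assoc)
    also have "\<dots> = 0" using f by (simp add: outer_mult mat0)
    finally have A: "?A $ i $ j * l = 0" for i j by (metis mult_mat_nth zero_index)
    have "?A \<noteq> 0" using f by (simp add: outer_eq_0_iff)
    then obtain i j where "?A $ i $ j \<noteq> 0" by (auto simp: vec_eq_iff)
    with A have "l = 0" by (metis mult_eq_0_iff)
    have zero: "c = 0" if "mat c ** outer p q = mat l" "p \<noteq> 0" "q \<noteq> 0" for c and p q :: "'a ^ 3"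
    proof -
      obtain i j where "p $ i \<noteq> 0" "q $ j \<noteq> 0" using \<open>p \<noteq> 0\<close> \<open>q \<noteq> 0\<close> by (auto simp: vec_eq_iff)
      moreover have "c * (p $ i * q $ j) = mat l $ i $ j"
        unfolding that(1)[symmetric] by (simp add: mat_mult_nth outer_def)
      ultimately show ?thesis using \<open>l = 0\<close> by (simp add: mat_def)
    qed
    show "dot3 f v' = 0 \<and> dot3 f' v = 0"
      using l f unfolding outer_mult by (auto dest: zero)
  next
    assume "dot3 f v' = 0 \<and> dot3 f' v = 0"
    then have "?A ** ?B = mat 0" "?B ** ?A = mat 0" by (simp_all add: outer_mult mat0 mat_0)
    then show "orth (of_mat w ?A) (of_mat w ?B)" unfolding * by blast
  qed
qed

lemma vertex_flag:
  assumes "flag v f" shows "vertex (of_mat w (outer v f))"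
proof -
  let ?x = "of_mat w (outer v f)"
  have "orth ?x ?x" using orth_flag assms by (simp add: flag_def)
  then have "okubo_norm ?x *s ?x = 0" using okubo_mult_left[of ?x ?x] by (simp add: orth_def)
  then show ?thesis using of_mat_outer_ne_0[OF assms] by (simp add: zero_divisor_iff)
qed

lemma square_zero_flag:
  assumes "vertex x" "x \<star> x = 0"
  obtains v f where "flag v f" "line x = flag_line v f"
proof -
  have "x \<noteq> 0" using assms(1) by (simp add: zero_divisor_iff)
  then obtain v f where "x = of_mat w (outer v f)" "v \<noteq> 0" "f \<noteq> 0" "dot3 f v = 0"
    using flagE assms(2) by blast
  then show ?thesis using that by (simp add: flag_def flag_line_def)
qed

lemma arc_flag_iff:
  assumes "flag v f" "flag v' f'"
  shows "(flag_line v f, flag_line v' f') \<in> parcs \<Gamma> \<longleftrightarrow>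
    flag_line v f \<noteq> flag_line v' f' \<and> dot3 f v' = 0 \<and> dot3 f' v = 0"
  unfolding flag_line_def arc_iff[OF assms[THEN vertex_flag]] orth_flag[OF assms] ..

lemma flag_line_eqD:
  assumes "flag v f" "flag v' f'" "flag_line v f = flag_line v' f'"
  shows "\<exists>a. v = a *s v'" "\<exists>b. f = b *s f'"
proof -
  obtain c where "of_mat w (outer v f) = c *s of_mat w (outer v' f')"
    using assms line_eq_iff of_mat_outer_ne_0 unfolding flag_line_def by blast
  then have "outer v f = mat c ** outer v' f'"
    using assms to_mat_flag to_mat_scale unfolding flag_def by metis
  then show "\<exists>a. v = a *s v'" "\<exists>b. f = b *s f'"
    using assms(1) outer_eq_scaleD unfolding flag_def by blast+
qed

lemma flag_line_scale:
  assumes "flag (a *s v) (b *s f)"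
  shows "flag_line (a *s v) (b *s f) = flag_line v f"
proof -
  have "a \<noteq> 0" "b \<noteq> 0" "dot3 f v = 0" using assms by (auto simp: flag_def)
  then have "of_mat w (outer (a *s v) (b *s f)) = (a * b) *s of_mat w (outer v f)"
    by (simp add: outer_scale of_mat_scale trace_outer)
  moreover have "a * b \<noteq> 0" using \<open>a \<noteq> 0\<close> \<open>b \<noteq> 0\<close> by simp
  ultimately show ?thesis
    unfolding flag_line_def line_eq_iff[OF of_mat_outer_ne_0[OF assms]] by blast
qed

lemma square_sole_neighbour:
  fixes x :: "'a okubo"
  assumes "vertex x" "x \<star> x \<noteq> 0" "(line x, z) \<in> parcs \<Gamma>"
  shows "z = line (x \<star> x)"
proof -
  obtain y where y: "z = line y" "vertex y" using assms(3) by (auto elim: arcE)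
  then have "orth x y" using assms arc_iff by blast
  moreover have "okubo_norm x = 0" using assms(1) by (simp add: zero_divisor_iff)
  ultimately obtain c where "y = c *s (x \<star> x)" using orth_square_unique assms(2) by blast
  moreover from this have "c \<noteq> 0" "y \<noteq> 0" using y by (auto simp: zero_divisor_iff)
  ultimately show ?thesis using y line_eq_iff by blast
qed

text \<open>A vertex with two different neighbours has square zero, because a nonzero square would
  span its only neighbour.\<close>

lemma inner_vertex_flag:
  fixes u :: "'a okubo set"
  assumes "(u, z) \<in> parcs \<Gamma>" "(z, u') \<in> parcs \<Gamma>" "u \<noteq> u'"
  obtains v f where "flag v f" "z = flag_line v f"
proof -
  obtain x where x: "z = line x" "vertex x" using assms(2) by (auto elim: arcE)
  have "(z, u) \<in> parcs \<Gamma>"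
    using assms(1) symmetric_orthogonality_graph by (auto simp: symmetric_def dest: symD)
  then have "x \<star> x = 0" using square_sole_neighbour x assms by metis
  then show ?thesis using square_zero_flag x that by metis
qed

text \<open>Each end of the chain keeps either the point or the line of the adjacent endpoint.
  Keeping points at both ends forces the two inner lines to be the line joining \<open>v\<close> and
  \<open>w'\<close>; keeping lines at both ends forces the inner points to be the intersection of
  \<open>f\<close> and \<open>g\<close>. The name \<open>w'\<close> avoids the cube root
  \<open>w\<close>.\<close>

lemma opposite_flag_chain:
  assumes "flag v f" "flag w' g" "dot3 f w' \<noteq> 0" "dot3 g v \<noteq> 0"
    and "flag a h" "flag b m" "dot3 f a = 0" "dot3 h v = 0" "dot3 h b = 0" "dot3 m a = 0"
      "dot3 m w' = 0" "dot3 g b = 0"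
  shows "flag_line a h = flag_line v (cross v w') \<and> flag_line b m = flag_line w' (cross v w') \<or>
    flag_line a h = flag_line (cross f g) f \<and> flag_line b m = flag_line (cross f g) g"
proof -
  have cross: "cross v w' \<noteq> 0" "cross f g \<noteq> 0" using flag_cross assms(1-3) by blast+
  note nz = assms(5,6)[unfolded flag_def]
  consider c d where "a = c *s v" "b = d *s w'" | c d where "a = c *s v" "m = d *s g"
    | c d where "h = c *s f" "b = d *s w'" | c d where "h = c *s f" "m = d *s g"
    using common_point_or_line[OF assms(1,5,7,8)] common_point_or_line[OF assms(2,6,12,11)] by blast
  then show ?thesis
  proof cases
    case 1
    then have "c \<noteq> 0" "d \<noteq> 0" using nz by auto
    then have h: "dot3 v h = 0" "dot3 w' h = 0" and m: "dot3 v m = 0" "dot3 w' m = 0"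
      using 1 assms(8-11) by (simp_all add: dot3_commute)
    obtain r where r: "h = r *s cross v w'" using h by (rule orthogonal_pairE[OF cross(1)])
    obtain s where s: "m = s *s cross v w'" using m by (rule orthogonal_pairE[OF cross(1)])
    show ?thesis
      using flag_line_scale[OF assms(5)[unfolded 1 r]] flag_line_scale[OF assms(6)[unfolded 1 s]]
      unfolding 1 r s by blast
  next
    \<comment> \<open>The inner adjacency \<open>dot3 m a = 0\<close> would put \<open>v\<close> on
      \<open>g\<close>; dually, the next case would put \<open>w'\<close> on
      \<open>f\<close>.\<close>
    case 2
    then show ?thesis using nz assms(4,10) by auto
  next
    case 3
    then show ?thesis using nz assms(3,9) by auto
  next
    case 4
    then have "c \<noteq> 0" "d \<noteq> 0" using nz by auto
    then have ab: "dot3 f b = 0" "dot3 g a = 0"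
      using 4 assms(9,10) by simp_all
    obtain r where r: "a = r *s cross f g"
      using assms(7) ab(2) by (rule orthogonal_pairE[OF cross(2)])
    obtain s where s: "b = s *s cross f g"
      using ab(1) assms(12) by (rule orthogonal_pairE[OF cross(2)])
    show ?thesis
      using flag_line_scale[OF assms(5)[unfolded 4 r]] flag_line_scale[OF assms(6)[unfolded 4 s]]
      unfolding 4 r s by blast
  qed
qed

text \<open>A common neighbour would consist of the intersection of \<open>f\<close> and
  \<open>g\<close> and the line joining \<open>v\<close> and \<open>w'\<close>. By
  \<open>dot3_cross_cross\<close> this point is not on this line.\<close>

lemma opposite_flags_no_common_neighbour:
  assumes "flag v f" "flag w' g" "dot3 f w' \<noteq> 0" "dot3 g v \<noteq> 0"
    and "flag a h" "dot3 f a = 0" "dot3 h v = 0" "dot3 g a = 0" "dot3 h w' = 0"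
  shows False
proof -
  have cross: "cross v w' \<noteq> 0" "cross f g \<noteq> 0" using flag_cross assms(1-3) by blast+
  obtain r where r: "a = r *s cross f g"
    using assms(6,8) by (rule orthogonal_pairE[OF cross(2)])
  obtain s where s: "h = s *s cross v w'"
    using assms(7,9)[unfolded dot3_commute[of h]] by (rule orthogonal_pairE[OF cross(1)])
  have "dot3 h a = r * s * (dot3 v f * dot3 w' g - dot3 v g * dot3 w' f)"
    unfolding r s by (simp add: dot3_cross_cross)
  moreover have "r \<noteq> 0" "s \<noteq> 0" "dot3 h a = 0" "dot3 v f = 0"
    using r s assms by (auto simp: flag_def dot3_commute)
  moreover have "dot3 v g \<noteq> 0" "dot3 w' f \<noteq> 0" using assms by (simp_all add: dot3_commute)
  ultimately show False by simp
qed

text \<open>As \<open>v\<close> lies on \<open>g\<close>, the intersection of \<open>f\<close> and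
  \<open>g\<close> is \<open>v\<close>, and the line joining \<open>v\<close> and \<open>w'\<close>
  is \<open>g\<close>.\<close>

lemma common_neighbour:
  assumes "flag v f" "flag w' g" "dot3 f w' \<noteq> 0" "dot3 g v = 0"
    and "flag a h" "dot3 f a = 0" "dot3 h v = 0" "dot3 g a = 0" "dot3 h w' = 0"
  shows "flag_line a h = flag_line v g"
proof -
  have cross: "cross v w' \<noteq> 0" "cross f g \<noteq> 0" using flag_cross assms(1-3) by blast+
  have dots: "dot3 f v = 0" "dot3 v g = 0" "dot3 w' g = 0" "dot3 v h = 0" "dot3 w' h = 0"
    using assms by (simp_all add: flag_def dot3_commute)
  obtain r where r: "a = r *s cross f g" using assms(6,8) by (rule orthogonal_pairE[OF cross(2)])
  obtain r' where r': "v = r' *s cross f g" using dots(1) assms(4) by (rule orthogonal_pairE[OF cross(2)])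
  obtain s where s: "h = s *s cross v w'" using dots(4,5) by (rule orthogonal_pairE[OF cross(1)])
  obtain s' where s': "g = s' *s cross v w'" using dots(2,3) by (rule orthogonal_pairE[OF cross(1)])
  have "v \<noteq> 0" "g \<noteq> 0" using assms(1,2) by (simp_all add: flag_def)
  then have "r' \<noteq> 0" "s' \<noteq> 0" using r' s' by (metis vector_smult_lzero)+
  then have "a = (r / r') *s v" "h = (s / s') *s g"
    unfolding r s by (subst r', simp, subst s', simp)
  then show ?thesis using flag_line_scale[of "r / r'" v "s / s'" g] assms(5) by simp
qed

section \<open>Distances and geodesics between two flags\<close>

lemma flag_line_in_pverts: "flag v f \<Longrightarrow> flag_line v f \<in> pverts \<Gamma>"
  using vertex_flag by (auto simp: orthogonality_graph_def flag_line_def)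

lemma flag_line_neqI:
  assumes "flag v f" "flag w' g" "dot3 f w' \<noteq> 0"
  shows "flag_line v f \<noteq> flag_line w' g" "flag_line w' g \<noteq> flag_line v f"
proof -
  show "flag_line w' g \<noteq> flag_line v f"
  proof
    assume "flag_line w' g = flag_line v f"
    then obtain a where "w' = a *s v" using flag_line_eqD(1)[OF assms(2,1)] by blast
    with assms(1,3) show False by (simp add: flag_def)
  qed
  then show "flag_line v f \<noteq> flag_line w' g" by metis
qed

lemma half_opposite_flags:
  assumes "flag v f" "flag w' g" "dot3 f w' \<noteq> 0" "dot3 g v = 0"
  defines "u \<equiv> flag_line v f" and "u' \<equiv> flag_line w' g"
  shows "at_distance \<Gamma> u 2 u'" "card (walks \<Gamma> u 2 u') = 1"
proof -
  let ?z = "flag_line v g"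
  have ne: "u \<noteq> u'" unfolding u_def u'_def using flag_line_neqI assms by blast
  have no_arc: "(u, u') \<notin> parcs \<Gamma>"
    using arc_flag_iff[OF assms(1,2)] assms(3) unfolding u_def u'_def by simp
  have vg: "flag v g" using assms by (simp add: flag_def)
  have "?z \<noteq> u'" unfolding u'_def
  proof
    assume "?z = flag_line w' g"
    then obtain a where "w' = a *s v" using flag_line_eqD(1)[OF assms(2) vg] by metis
    with assms(1,3) show False by (simp add: flag_def)
  qed
  moreover have "u \<noteq> ?z" unfolding u_def
  proof
    assume "flag_line v f = ?z"
    then obtain a where "f = a *s g" using flag_line_eqD(2)[OF assms(1) vg] by blast
    with assms(2,3) show False by (simp add: flag_def)
  qed
  ultimately have z: "(u, ?z) \<in> parcs \<Gamma>" "(?z, u') \<in> parcs \<Gamma>"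
    unfolding u_def u'_def arc_flag_iff[OF assms(1) vg] arc_flag_iff[OF vg assms(2)]
    using assms(1,2,4) by (simp_all add: flag_def)
  have "z = ?z" if arcs: "(u, z) \<in> parcs \<Gamma>" "(z, u') \<in> parcs \<Gamma>" for z
  proof -
    obtain a h where ah: "flag a h" "z = flag_line a h"
      using inner_vertex_flag[OF arcs ne] by blast
    then show ?thesis
      using arcs common_neighbour[OF assms(1-4) ah(1)]
      unfolding u_def u'_def ah arc_flag_iff[OF assms(1) ah(1)] arc_flag_iff[OF ah(1) assms(2)]
      by blast
  qed
  with z have walks: "walks \<Gamma> u 2 u' = {[(u, ?z), (?z, u')]}"
    unfolding numeral_2_eq_2 walks_2[OF wf_orthogonality_graph] by blast
  have "walks \<Gamma> u j u' = {}" if "j < 2" for j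
  proof -
    have "j = 0 \<or> j = Suc 0" using that by linarith
    then show ?thesis
      by (elim disjE) (simp_all add: ne no_arc walks_0 walks_1[OF wf_orthogonality_graph])
  qed
  with walks show "at_distance \<Gamma> u 2 u'" by (simp add: at_distance_def)
  show "card (walks \<Gamma> u 2 u') = 1" unfolding walks by simp
qed

text \<open>The halves of the hexagon are \<open>?p\<close>, which runs through the joining line
  \<open>?h\<close>, and \<open>?q\<close>, which runs through the intersection point
  \<open>?a\<close>.\<close>

lemma opposite_flags:
  assumes "flag v f" "flag w' g" "dot3 f w' \<noteq> 0" "dot3 g v \<noteq> 0"
  defines "u \<equiv> flag_line v f" and "u' \<equiv> flag_line w' g"
  shows "at_distance \<Gamma> u 3 u'" "card (walks \<Gamma> u 3 u') = 2"
proof -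
  let ?h = "cross v w'" and ?a = "cross f g"
  let ?p = "[(u, flag_line v ?h), (flag_line v ?h, flag_line w' ?h), (flag_line w' ?h, u')]"
  let ?q = "[(u, flag_line ?a f), (flag_line ?a f, flag_line ?a g), (flag_line ?a g, u')]"
  have three: "3 = Suc (Suc (Suc 0))" by simp
  have cross: "?h \<noteq> 0" "?a \<noteq> 0" using flag_cross assms(1-3) by blast+
  have d: "v \<noteq> 0" "w' \<noteq> 0" "f \<noteq> 0" "g \<noteq> 0" "dot3 f v = 0" "dot3 g w' = 0"
    using assms by (simp_all add: flag_def)
  have flags: "flag v ?h" "flag w' ?h" "flag ?a f" "flag ?a g"
    using cross d by (simp_all add: flag_def)
  have ne: "u \<noteq> u'" unfolding u_def u'_def using flag_line_neqI assms by blast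
  have no_arc: "(u, u') \<notin> parcs \<Gamma>"
    using arc_flag_iff[OF assms(1,2)] assms(3) unfolding u_def u'_def by simp
  have neq: "\<not> (\<exists>c. w' = c *s v)" "\<not> (\<exists>c. v = c *s w')" "\<not> (\<exists>c. f = c *s g)" "\<not> (\<exists>c. g = c *s f)"
    using assms(3,4) d by auto
  \<comment> \<open>The line \<open>?h\<close> contains \<open>v\<close> and \<open>w'\<close>,
    while \<open>f\<close> misses \<open>w'\<close> and \<open>g\<close> misses \<open>v\<close>;
    dually for the point \<open>?a\<close>.\<close>
  have fh: "f \<noteq> c *s ?h" "g \<noteq> c *s ?h" "v \<noteq> c *s ?a" "w' \<noteq> c *s ?a" for c
    using assms(3,4) by auto
  have p: "(u, flag_line v ?h) \<in> parcs \<Gamma>" "(flag_line v ?h, flag_line w' ?h) \<in> parcs \<Gamma>"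
     "(flag_line w' ?h, u') \<in> parcs \<Gamma>"
    unfolding u_def u'_def arc_flag_iff[OF assms(1) flags(1)] arc_flag_iff[OF flags(1,2)]
      arc_flag_iff[OF flags(2) assms(2)]
    using d flag_line_eqD[OF assms(1) flags(1)] flag_line_eqD[OF flags(1,2)]
      flag_line_eqD[OF assms(2) flags(2)] neq fh by auto
  have q: "(u, flag_line ?a f) \<in> parcs \<Gamma>" "(flag_line ?a f, flag_line ?a g) \<in> parcs \<Gamma>"
     "(flag_line ?a g, u') \<in> parcs \<Gamma>"
    unfolding u_def u'_def arc_flag_iff[OF assms(1) flags(3)] arc_flag_iff[OF flags(3,4)]
      arc_flag_iff[OF flags(4) assms(2)]
    using d flag_line_eqD[OF assms(1) flags(3)] flag_line_eqD[OF flags(3,4)]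
      flag_line_eqD[OF assms(2) flags(4)] neq fh by auto
  have "flag_line v ?h \<noteq> flag_line ?a f"
    using flag_line_eqD(1)[OF flags(1,3)] fh by blast
  then have pq: "?p \<noteq> ?q" by simp
  have walk: "[(u, z), (z, z'), (z', u')] \<in> {?p, ?q}"
    if arcs: "(u, z) \<in> parcs \<Gamma>" "(z, z') \<in> parcs \<Gamma>" "(z', u') \<in> parcs \<Gamma>" for z z'
  proof -
    \<comment> \<open>Each inner vertex has two different neighbours on the walk, as otherwise
      \<open>u\<close> and \<open>u'\<close> would be adjacent.\<close>
    have z: "u \<noteq> z'" "z \<noteq> u'" using arcs no_arc by blast+
    obtain a h where ah: "flag a h" "z = flag_line a h"
      using inner_vertex_flag[OF arcs(1,2) z(1)] by blast
    obtain b m where bm: "flag b m" "z' = flag_line b m"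
      using inner_vertex_flag[OF arcs(2,3) z(2)] by blast
    have "z = flag_line v ?h \<and> z' = flag_line w' ?h \<or> z = flag_line ?a f \<and> z' = flag_line ?a g"
      using arcs opposite_flag_chain[OF assms(1-4) ah(1) bm(1)]
      unfolding u_def u'_def ah bm arc_flag_iff[OF assms(1) ah(1)] arc_flag_iff[OF ah(1) bm(1)]
        arc_flag_iff[OF bm(1) assms(2)] by blast
    then show ?thesis by blast
  qed
  have walks: "walks \<Gamma> u 3 u' = {?p, ?q}"
  proof
    show "walks \<Gamma> u 3 u' \<subseteq> {?p, ?q}"
      using walk unfolding three walks_3[OF wf_orthogonality_graph] by blast
    show "{?p, ?q} \<subseteq> walks \<Gamma> u 3 u'"
      using p q unfolding three walks_3[OF wf_orthogonality_graph] by blast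
  qed
  have no_common: False if arcs: "(u, z) \<in> parcs \<Gamma>" "(z, u') \<in> parcs \<Gamma>" for z
  proof -
    obtain a h where ah: "flag a h" "z = flag_line a h"
      using inner_vertex_flag[OF arcs ne] by blast
    then show ?thesis
      using arcs opposite_flags_no_common_neighbour[OF assms(1-4) ah(1)]
      unfolding u_def u'_def ah arc_flag_iff[OF assms(1) ah(1)] arc_flag_iff[OF ah(1) assms(2)]
      by blast
  qed
  have "walks \<Gamma> u j u' = {}" if "j < 3" for j
  proof -
    have "j = 0 \<or> j = Suc 0 \<or> j = Suc (Suc 0)" using that by linarith
    moreover have "walks \<Gamma> u (Suc (Suc 0)) u' = {}"
      unfolding walks_2[OF wf_orthogonality_graph] using no_common by blast
    ultimately show ?thesis
      by (elim disjE) (simp_all add: ne no_arc walks_0 walks_1[OF wf_orthogonality_graph])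
  qed
  with walks show "at_distance \<Gamma> u 3 u'" by (simp add: at_distance_def)
  show "card (walks \<Gamma> u 3 u') = 2" unfolding walks using pq by (simp only: card_2_iff) blast
qed

text \<open>The relative position of the flags, read off from the two mixed incidences, decides the
  distance: equal, adjacent, half opposite in two ways exchanged by reversal, or opposite.\<close>

lemma flag_geodesics:
  assumes "flag v f" "flag w' g" "at_distance \<Gamma> (flag_line v f) k (flag_line w' g)"
  shows "k \<le> 3 \<and> card (walks \<Gamma> (flag_line v f) k (flag_line w' g)) = (if k = 3 then 2 else 1)"
proof -
  let ?u = "flag_line v f" and ?u' = "flag_line w' g"
  note wf = wf_orthogonality_graph and sym = symmetric_orthogonality_graph
  consider "?u = ?u'" | "?u \<noteq> ?u'" "dot3 f w' = 0" "dot3 g v = 0"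
    | "dot3 f w' \<noteq> 0" "dot3 g v = 0" | "dot3 f w' = 0" "dot3 g v \<noteq> 0"
    | "dot3 f w' \<noteq> 0" "dot3 g v \<noteq> 0" by blast
  then show ?thesis
  proof cases
    case 1
    then have walks: "walks \<Gamma> ?u 0 ?u' = {[]}"
      using flag_line_in_pverts[OF assms(1)] by (simp add: walks_0)
    then have "at_distance \<Gamma> ?u 0 ?u'" by (simp add: at_distance_def)
    then have "k = 0" by (rule at_distance_unique[OF assms(3)])
    then show ?thesis using walks by simp
  next
    case 2
    then have walks: "walks \<Gamma> ?u (Suc 0) ?u' = {[(?u, ?u')]}"
      using arc_flag_iff[OF assms(1,2)] by (simp add: walks_1[OF wf])
    with 2 have "at_distance \<Gamma> ?u (Suc 0) ?u'" by (simp add: at_distance_def walks_0)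
    then have "k = Suc 0" by (rule at_distance_unique[OF assms(3)])
    then show ?thesis using walks by simp
  next
    case 3
    note half = half_opposite_flags[OF assms(1,2) 3]
    from half(1) have "k = 2" by (rule at_distance_unique[OF assms(3)])
    then show ?thesis using half by simp
  next
    case 4
    note half = half_opposite_flags[OF assms(2,1) 4(2,1)]
    from at_distance_commute[OF wf sym half(1)] have "k = 2" by (rule at_distance_unique[OF assms(3)])
    then show ?thesis using half(2) card_walks_commute[OF wf sym, of ?u 2 ?u'] by simp
  next
    case 5
    note opp = opposite_flags[OF assms(1,2) 5]
    from opp(1) have "k = 3" by (rule at_distance_unique[OF assms(3)])
    then show ?thesis using opp by simp
  qed
qed

section \<open>Reduction of arbitrary endpoints to flags\<close>

lemma square_zero_geodesics:
  fixes x y :: "'a okubo"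
  assumes "vertex x" "vertex y" "x \<star> x = 0" "y \<star> y = 0" "at_distance \<Gamma> (line x) k (line y)"
  shows "k \<le> 3 \<and> card (walks \<Gamma> (line x) k (line y)) = (if k = 3 then 2 else 1)"
  using flag_geodesics assms square_zero_flag by metis

lemma square_step:
  fixes x :: "'a okubo"
  assumes "vertex x" "x \<star> x \<noteq> 0" "at_distance \<Gamma> (line x) (Suc k) v"
  shows "at_distance \<Gamma> (line (x \<star> x)) k v"
    "card (walks \<Gamma> (line x) (Suc k) v) = card (walks \<Gamma> (line (x \<star> x)) k v)"
  using sole_neighbour[OF wf_orthogonality_graph assms(3)] square_sole_neighbour[OF assms(1,2)]
  by blast+

lemma zero_geodesic:
  assumes "at_distance \<Gamma> u 0 v" shows "card (walks \<Gamma> u 0 v) = 1"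
  using assms by (auto simp: at_distance_def walks_0 split: if_splits)

text \<open>The only neighbour of \<open>[x]\<close> is \<open>[x \<star> x]\<close>, whose only
  neighbour is \<open>[x]\<close> again, so a geodesic with two or more arcs would return to its
  start.\<close>

lemma isolated_edge_geodesics:
  fixes x :: "'a okubo"
  assumes "vertex x" "x \<star> x \<noteq> 0" "(x \<star> x) \<star> (x \<star> x) \<noteq> 0" "at_distance \<Gamma> (line x) k v"
  shows "k \<le> 1 \<and> card (walks \<Gamma> (line x) k v) = 1"
proof -
  consider "k = 0" | "k = Suc 0" | j where "k = Suc (Suc j)" by (metis not0_implies_Suc)
  then show ?thesis
  proof cases
    case 1
    then show ?thesis using assms(4) zero_geodesic by blast
  next
    case 2
    then show ?thesis
      using square_step[OF assms(1,2)] assms(4) zero_geodesic by (metis le_refl One_nat_def)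
  next
    case 3
    let ?s = "x \<star> x"
    have s: "vertex ?s" using vertex_square assms(1,2) .
    have n: "okubo_norm x = 0" "okubo_norm ?s = 0" "x \<noteq> 0"
      using assms(1) s by (simp_all add: zero_divisor_iff)
    have "orth ?s x" using n by (simp add: orth_def okubo_mult_left okubo_mult_right)
    then obtain c where c: "x = c *s (?s \<star> ?s)" using orth_square_unique n(2) assms(3) by blast
    then have "c \<noteq> 0" using n by auto
    with c have "line x = line (?s \<star> ?s)" using line_eq_iff n by blast
    moreover have "at_distance \<Gamma> (line ?s) (Suc j) v"
      using square_step(1)[OF assms(1,2)] assms(4) 3 by blast
    then have "at_distance \<Gamma> (line (?s \<star> ?s)) j v" using square_step(1)[OF s assms(3)] by blast
    ultimately have "at_distance \<Gamma> (line x) j v" by simp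
    \<comment> \<open>The vertex \<open>v\<close> would be both at distance \<open>j\<close> and at
      distance \<open>j + 2\<close> from \<open>[x]\<close>.\<close>
    then have "k = j" by (rule at_distance_unique[OF assms(4)])
    with 3 show ?thesis by simp
  qed
qed

text \<open>The arc at \<open>[y]\<close> is forced, so deleting it keeps the number of geodesics
  and moves the exceptional length from 3 to 4. Length zero is separate, having no arc to
  delete.\<close>

lemma square_zero_left_geodesics:
  fixes x y :: "'a okubo"
  assumes "vertex x" "vertex y" "x \<star> x = 0" "y \<star> y \<noteq> 0" "(y \<star> y) \<star> (y \<star> y) = 0"
    "at_distance \<Gamma> (line x) k (line y)"
  shows "k \<le> 4 \<and> card (walks \<Gamma> (line x) k (line y)) = (if k = 4 then 2 else 1)"
proof (cases k)
  case 0
  then show ?thesis using assms(6) zero_geodesic by auto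
next
  case (Suc j)
  note wf = wf_orthogonality_graph and sym = symmetric_orthogonality_graph
  have "at_distance \<Gamma> (line y) (Suc j) (line x)"
    using assms(6) Suc at_distance_commute[OF wf sym] by blast
  note step = square_step[OF assms(2,4) this]
  have "vertex (y \<star> y)" using vertex_square assms(2,4) .
  from square_zero_geodesics[OF this assms(1,5,3) step(1)] show ?thesis
    using step(2) Suc card_walks_commute[OF wf sym, of "line x" k "line y"] by simp
qed

text \<open>Deleting the forced arc at \<open>[x]\<close> leads to the preceding situation and moves
  the exceptional length from 4 to 5.\<close>

lemma nonzero_squares_geodesics:
  fixes x y :: "'a okubo"
  assumes "vertex x" "vertex y" "x \<star> x \<noteq> 0" "(x \<star> x) \<star> (x \<star> x) = 0"
    "y \<star> y \<noteq> 0" "(y \<star> y) \<star> (y \<star> y) = 0" "at_distance \<Gamma> (line x) k (line y)"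
  shows "card (walks \<Gamma> (line x) k (line y)) = (if k = 5 then 2 else 1)"
proof (cases k)
  case 0
  then show ?thesis using assms(7) zero_geodesic by auto
next
  case (Suc j)
  note step = square_step[OF assms(1,3) assms(7)[unfolded Suc]]
  have "vertex (x \<star> x)" using vertex_square assms(1,3) .
  from square_zero_left_geodesics[OF this assms(2,4,5,6) step(1)] show ?thesis
    using step(2) Suc by simp
qed

text \<open>The cases record whether each endpoint lies on an isolated edge, is a flag, or hangs on
  a flag. The length bounds of the individual lemmas exclude the remaining alternatives of the
  condition.\<close>

lemma card_geodesics:
  fixes x y :: "'a okubo"
  assumes "vertex x" "vertex y" "at_distance \<Gamma> (line x) k (line y)"
  shows "card (walks \<Gamma> (line x) k (line y)) =
    (if k = 3 \<and> x \<star> x = 0 \<and> y \<star> y = 0 \<or> k = 4 \<and> (x \<star> x = 0 \<or> y \<star> y = 0) \<or> k = 5 then 2 else 1)"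
proof -
  note wf = wf_orthogonality_graph and sym = symmetric_orthogonality_graph
  have swap: "at_distance \<Gamma> (line y) k (line x)"
    "card (walks \<Gamma> (line x) k (line y)) = card (walks \<Gamma> (line y) k (line x))"
    using assms(3) at_distance_commute[OF wf sym] card_walks_commute[OF wf sym] by blast+
  consider "x \<star> x \<noteq> 0" "(x \<star> x) \<star> (x \<star> x) \<noteq> 0" | "y \<star> y \<noteq> 0" "(y \<star> y) \<star> (y \<star> y) \<noteq> 0"
    | "x \<star> x = 0" "y \<star> y = 0" | "x \<star> x = 0" "y \<star> y \<noteq> 0" "(y \<star> y) \<star> (y \<star> y) = 0"
    | "y \<star> y = 0" "x \<star> x \<noteq> 0" "(x \<star> x) \<star> (x \<star> x) = 0"
    | "x \<star> x \<noteq> 0" "(x \<star> x) \<star> (x \<star> x) = 0" "y \<star> y \<noteq> 0" "(y \<star> y) \<star> (y \<star> y) = 0"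
    by blast
  then show ?thesis
  proof cases
    case 1
    from isolated_edge_geodesics[OF assms(1) 1 assms(3)] show ?thesis by auto
  next
    case 2
    from isolated_edge_geodesics[OF assms(2) 2 swap(1)] show ?thesis using swap(2) by auto
  next
    case 3
    from square_zero_geodesics[OF assms(1,2) 3 assms(3)] show ?thesis using 3 by auto
  next
    case 4
    from square_zero_left_geodesics[OF assms(1,2) 4 assms(3)] show ?thesis using 4 by auto
  next
    case 5
    from square_zero_left_geodesics[OF assms(2,1) 5 swap(1)] show ?thesis using 5 swap(2) by auto
  next
    case 6
    from nonzero_squares_geodesics[OF assms(1,2) 6 assms(3)] show ?thesis using 6 by auto
  qed
qed

end

text \<open>Cancelling \<open>w - 1\<close> in \<open>w ^ 3 - 1\<close> gives the quadratic
  equation. If 3 were zero, that quadratic would be the square of \<open>w - 1\<close> and force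
  \<open>w = 1\<close>.\<close>

lemma cube_root_primitive:
  assumes "primitive_cube_root_of_unity (w :: 'a::field)"
  shows "cube_root w"
proof
  have w: "w ^ 3 = 1" "w \<noteq> 1"
    using assms unfolding primitive_cube_root_of_unity_def by (auto dest: spec[of _ 1])
  have "(w - 1) * (w\<^sup>2 + w + 1) = w ^ 3 - 1"
    by (simp add: algebra_simps power2_eq_square power3_eq_cube)
  then have sum: "w\<^sup>2 + w + 1 = 0" using w by simp
  show w2: "w\<^sup>2 = - 1 - w" using sum by (simp add: eq_neg_iff_add_eq_0 algebra_simps)
  show "(3 :: 'a) \<noteq> 0"
  proof
    assume "(3 :: 'a) = 0"
    have "(w - 1)\<^sup>2 = (w\<^sup>2 + w + 1) - 3 * w" by (simp add: algebra_simps power2_eq_square)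
    also have "\<dots> = 0" unfolding sum \<open>3 = 0\<close> by simp
    finally show False using w by simp
  qed
qed

theorem corollary4p3:
  fixes x y :: "'a::field okubo" and k :: nat
  assumes "CHAR('a) \<noteq> 3"
    and "\<exists>w::'a. primitive_cube_root_of_unity w"
    and "x \<in> zero_divisors" and "y \<in> zero_divisors"
    and "graph_distance orthogonality_graph (line x) (line y) = ereal (real k)"
    and "k \<le> 5"
  shows "((\<exists>!p. p \<in> paths_of_length orthogonality_graph (line x) (line y) k) \<or>
          card (paths_of_length orthogonality_graph (line x) (line y) k) = 2) \<and>
         (card (paths_of_length orthogonality_graph (line x) (line y) k) = 2 \<longleftrightarrow>
            (k = 3 \<and> x \<star> x = 0 \<and> y \<star> y = 0) \<or>
            (k = 4 \<and> (x \<star> x = 0 \<or> y \<star> y = 0)) \<or>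
            k = 5)"
proof -
  obtain w :: 'a where "primitive_cube_root_of_unity w" using assms(2) by blast
  then interpret cube_root w by (rule cube_root_primitive)
  have "vertex x" "vertex y" using assms(3,4) by (simp_all add: zero_divisor_iff)
  moreover have dist: "at_distance \<Gamma> (line x) k (line y)"
    using wf_orthogonality_graph assms(5) by (rule at_distance_graph_distance)
  ultimately have card: "card (walks \<Gamma> (line x) k (line y)) =
    (if k = 3 \<and> x \<star> x = 0 \<and> y \<star> y = 0 \<or> k = 4 \<and> (x \<star> x = 0 \<or> y \<star> y = 0) \<or> k = 5 then 2 else 1)"
    by (rule card_geodesics)
  \<comment> \<open>An infinite set has \<open>card\<close> 0, so cardinality 1 really means a
    singleton.\<close>
  moreover have "(\<exists>!p. p \<in> A) \<longleftrightarrow> card A = 1" for A :: "('a okubo set \<times> 'a okubo set) list set"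
    by (auto simp: card_1_singleton_iff)
  ultimately show ?thesis
    unfolding paths_of_length_eq_walks[OF wf_orthogonality_graph dist] by simp
qed

end
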